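(* Let $\phi\in\mathbb{R}$ with $\sin(2\phi)\neq0$, let $\chi_1,\dots,\chi_4\in\mathbb{C}$, $\lambda\in\mathbb{C}$, let $$z_1=e^{i\phi},\quad z_2=-e^{-i\phi},\quad z_3=-e^{i\phi},\quad z_4=e^{-i\phi},$$ $q_j=\frac1{16}\left(\sin(2\chi_j)\right)^2\prod_{k\neq j}(z_j-z_k)$ for $j=1,\dots,4$, and $\rho_2=(\sin(2\chi_1))^2+(\sin(2\chi_3))^2-(\sin(2\chi_2))^2-(\sin(2\chi_4))^2$. Consider the symmetric general Heun equation with parameters $(z_j;q_j;\lambda)$: $$\mathcal{F}''+\frac12\left(\sum_{j=1}^4\frac1{z-z_j}\right)\mathcal{F}'+\frac1{P(z)}\left(\lambda+\sum_{j=1}^4\frac{q_j}{z-z_j}\right)\mathcal{F}=0,\qquad P(z)=\prod_{j=1}^4(z-z_j).$$ Then: (a) The equation preserves its form under the substitutions $$z\to1/z,\quad z_j\to1/z_j,\quad \mathcal{F}(z)\to\mathcal{F}(1/z),\quad P(z)\to P(1/z),\quad \lambda\to\lambda-\tfrac i4\sin(2\phi)\rho_2,\quad q_j\to-q_j/z_j^2 .$$ That is, for an analytic function $\mathcal{F}$ on an open set $U\subset\mathbb{C}\setminus\{0,z_1,\dots,z_4\}$, $\mathcal{F}$ solves the equation with parameters $(z_j;q_j;\lambda)$ on $U$ if and only if the function $w\mapsto\mathcal{F}(1/w)$ solves on $\{w: 1/w\in U\}$ the equation, in the independent variable $w$, with parameters $\left(1/z_j;\,-q_j/z_j^2;\,\lambda-\tfrac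 i4\sin(2\phi)\rho_2\right)$. (b) In this way one obtains from Taylor series solutions new solutions in the form of Laurent series: if $\sum_{n=0}^\infty f_nw^n$ is the Taylor series at $w=0$ of a solution of the equation (in the variable $w$) with parameters $\left(1/z_j;\,-q_j/z_j^2;\,\lambda-\tfrac i4\sin(2\phi)\rho_2\right)$, then the series $\sum_{n=0}^\infty f_nz^{-n}$ is absolutely convergent for every $z\in\mathbb{C}$ with $|z|>1$ and its sum is there a solution of the equation with parameters $(z_j;q_j;\lambda)$.
   Context: The equation with parameters $(a_j;b_j;\mu)$ in the variable $w$ means $\mathcal{F}''(w)+\frac12\left(\sum_{j=1}^4\frac1{w-a_j}\right)\mathcal{F}'(w)+\frac1{\prod_{j=1}^4(w-a_j)}\left(\mu+\sum_{j=1}^4\frac{b_j}{w-a_j}\right)\mathcal{F}(w)=0$; in particular, in the substitution $P(z)\to P(1/z)$ the roots $z_j$ are also replaced by $1/z_j$. The situation $\phi\in\mathbb{R}$, in which the four singular points lie on the unit circle, is called the circular case. The condition $\sin(2\phi)\neq0$ says that $z_1,\dots,z_4$ are distinct. *)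

theory Defs
  imports "HOL-Complex_Analysis.Complex_Analysis"
begin

(* Solutions on U of the equation with parameters (a_j; b_j; mu), j = 1, ..., 4.  The domain
   is required to be open and to avoid the singular points a_j, so that no division by zero
   occurs in the coefficients.  Connectedness of U is not required. *)
definition heun_solution_on ::
  "(nat \<Rightarrow> complex) \<Rightarrow> (nat \<Rightarrow> complex) \<Rightarrow> complex \<Rightarrow> complex set \<Rightarrow> (complex \<Rightarrow> complex) \<Rightarrow> bool"
where
  "heun_solution_on a b mu U F \<longleftrightarrow>
     open U \<and> (\<forall>j\<in>{1..4}. a j \<notin> U) \<and> F holomorphic_on U \<and>
     (\<forall>w\<in>U. deriv (deriv F) w + 1/2 * (\<Sum>j=1..4. 1 / (w - a j)) * deriv F w
            + 1 / (\<Prod>j=1..4. w - a j) * (mu + (\<Sum>j=1..4. b j / (w - a j))) * F w = 0)"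

end

theory Submission
  imports Defs
begin

text \<open>
  Substituting \<open>z = 1 / w\<close>, the terms in \<open>F'\<close> produced by the second derivative cancel against
  the first-order coefficient because there are four singular points of weight \<open>1/2\<close>. As
  \<open>z\<^sub>1 z\<^sub>2 z\<^sub>3 z\<^sub>4 = 1\<close>, the polynomial \<open>P\<close> keeps its leading coefficient, and the partial fractions
  shift \<open>\<lambda>\<close> by \<open>\<Sum> q\<^sub>j / z\<^sub>j\<close>; here \<open>P' (z\<^sub>j) = \<plusminus>4 i sin (2\<phi>) z\<^sub>j\<close> evaluates the shift.

  For the Laurent series, the recurrence for the Taylor coefficients of a solution at the ordinary
  point \<open>0\<close> shows that its Taylor series converges on the whole unit disc, the identity theorem extends the
  equation to that disc, and the substitution carries it to \<open>|z| > 1\<close>.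
\<close>

section \<open>Power series solutions of second-order linear equations\<close>

text \<open>The recurrence bounds each coefficient by a convolution of the earlier ones with the
  coefficients of \<open>P\<close> and \<open>Q\<close>, which are O(\<open>s ^ (-n)\<close>) for
  every \<open>s\<close> below their radii. Partial sums of the weighted coefficients of
  \<open>A\<close> then grow by factors \<open>1 + O(1/n)\<close> only, so any smaller radius
  \<open>t < s\<close> gives convergence.\<close>

lemma fps_linear_ode2_conv_radius:
  fixes A P Q :: "complex fps"
  assumes ode: "fps_deriv (fps_deriv A) + P * fps_deriv A + Q * A = 0"
  shows "min (fps_conv_radius P) (fps_conv_radius Q) \<le> fps_conv_radius A"
  unfolding fps_conv_radius_def[of A]
proof (rule conv_radius_geI_ex')
  fix t :: real
  assume t: "0 < t" "ereal t < min (fps_conv_radius P) (fps_conv_radius Q)"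
  \<comment> \<open>Estimates are made at the larger radius \<open>s\<close>; the quotient
    \<open>c = t / s < 1\<close> supplies the geometric decay at \<open>t\<close>.\<close>
  obtain s where s: "t < s" "ereal s < min (fps_conv_radius P) (fps_conv_radius Q)"
    using ereal_dense2[OF t(2)] by auto
  have ts: "0 < t" "t < s" "0 < s"
    using t s by auto
  define c where "c = t / s"
  have c: "0 < c" "c < 1" "t = c * s"
    using ts by (auto simp: c_def field_simps)
  have bounded_coeffs: "\<exists>M. \<forall>n. norm (fps_nth X n) * s ^ n \<le> M"
    if "ereal s < fps_conv_radius X" for X :: "complex fps"
  proof -
    have "summable (\<lambda>n. norm (fps_nth X n * of_real s ^ n))"
      using that ts by (intro abs_summable_in_conv_radius) (simp add: fps_conv_radius_def)
    then have "bounded (range (\<lambda>n. norm (fps_nth X n * of_real s ^ n)))"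
      by (rule summable_imp_bounded)
    then show ?thesis
      using ts by (auto simp: bounded_iff norm_mult norm_power)
  qed
  obtain M1 where M1: "\<And>n. norm (fps_nth P n) * s ^ n \<le> M1"
    using bounded_coeffs[of P] s by auto
  obtain M2 where M2: "\<And>n. norm (fps_nth Q n) * s ^ n \<le> M2"
    using bounded_coeffs[of Q] s by auto
  \<comment> \<open>The weight \<open>s ^ (n + 2)\<close> splits into \<open>s ^ (i + 1)\<close> for
    \<open>u (i + 1)\<close>, \<open>s ^ (n - i)\<close> for \<open>P\<close> and one spare
    \<open>s\<close>; beside \<open>u i\<close> and \<open>Q\<close> two spare factors
    remain.\<close>
  define M where "M = max (s * M1) (s\<^sup>2 * M2)"
  have "0 \<le> M1"
    using M1[of 0] norm_ge_zero order_trans by (metis mult.right_neutral power_0)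
  then have M: "0 \<le> M" "s * M1 \<le> M" "s\<^sup>2 * M2 \<le> M"
    using ts by (auto simp: M_def le_max_iff_disj)
  define u where "u n = norm (fps_nth A n) * s ^ n" for n
  have u_nonneg: "0 \<le> u n" for n
    using ts by (simp add: u_def)
  define S where "S n = (\<Sum>i\<le>n. real (Suc i) * u (Suc i) + u i)" for n
  have S_nonneg: "0 \<le> S n" for n
    unfolding S_def by (intro sum_nonneg add_nonneg_nonneg mult_nonneg_nonneg u_nonneg) auto
  have recurrence: "real (n + 1) * (real (n + 2) * u (n + 2)) \<le> M * S n" for n
  proof -
    have "fps_nth (fps_deriv (fps_deriv A) + fps_deriv A * P + A * Q) n = 0"
      using ode by (simp add: mult.commute)
    then have "of_nat (n + 1) * (of_nat (n + 2) * fps_nth A (n + 2))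
        + (\<Sum>i\<le>n. of_nat (i + 1) * fps_nth A (i + 1) * fps_nth P (n - i)
                  + fps_nth A i * fps_nth Q (n - i)) = 0"
      by (simp add: fps_mult_nth sum.distrib atLeast0AtMost add.assoc)
    then have "of_nat (n + 1) * (of_nat (n + 2) * fps_nth A (n + 2)) =
        - (\<Sum>i\<le>n. of_nat (i + 1) * fps_nth A (i + 1) * fps_nth P (n - i)
                  + fps_nth A i * fps_nth Q (n - i))"
      by (simp only: eq_neg_iff_add_eq_0)
    from arg_cong[OF this, of norm]
    have "real (n + 1) * (real (n + 2) * norm (fps_nth A (n + 2))) =
        norm (\<Sum>i\<le>n. of_nat (i + 1) * fps_nth A (i + 1) * fps_nth P (n - i)
                  + fps_nth A i * fps_nth Q (n - i))"
      by (simp only: norm_minus_cancel norm_mult norm_of_nat)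
    also have "\<dots> \<le> (\<Sum>i\<le>n. real (i + 1) * norm (fps_nth A (i + 1)) * norm (fps_nth P (n - i))
                  + norm (fps_nth A i) * norm (fps_nth Q (n - i)))"
      by (intro sum_norm_le order_trans[OF norm_triangle_ineq])
         (simp only: norm_mult norm_of_nat order_refl)
    finally have "real (n + 1) * (real (n + 2) * norm (fps_nth A (n + 2))) * s ^ (n + 2) \<le>
        (\<Sum>i\<le>n. real (i + 1) * norm (fps_nth A (i + 1)) * norm (fps_nth P (n - i))
                  + norm (fps_nth A i) * norm (fps_nth Q (n - i))) * s ^ (n + 2)"
      by (rule mult_right_mono) (use ts in simp)
    also have "\<dots> = (\<Sum>i\<le>n. real (i + 1) * u (i + 1) * (s * (norm (fps_nth P (n - i)) * s ^ (n - i)))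
                  + u i * (s\<^sup>2 * (norm (fps_nth Q (n - i)) * s ^ (n - i))))"
      unfolding sum_distrib_right
    proof (rule sum.cong)
      fix i assume "i \<in> {..n}"
      \<comment> \<open>This removes the truncated subtraction \<open>n - i\<close>, so that the
        power of \<open>s\<close> can be split.\<close>
      then obtain k where "n = i + k"
        using le_Suc_ex by auto
      then show "(real (i + 1) * norm (fps_nth A (i + 1)) * norm (fps_nth P (n - i))
                  + norm (fps_nth A i) * norm (fps_nth Q (n - i))) * s ^ (n + 2) =
          real (i + 1) * u (i + 1) * (s * (norm (fps_nth P (n - i)) * s ^ (n - i)))
                  + u i * (s\<^sup>2 * (norm (fps_nth Q (n - i)) * s ^ (n - i)))"
        by (simp add: u_def power_add power2_eq_square algebra_simps)
    qed auto
    also have "\<dots> \<le> (\<Sum>i\<le>n. real (i + 1) * u (i + 1) * M + u i * M)"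
    proof (intro sum_mono add_mono mult_left_mono)
      fix i
      show "s * (norm (fps_nth P (n - i)) * s ^ (n - i)) \<le> M"
        using mult_left_mono[OF M1[of "n - i"], of s] M ts by linarith
      show "s\<^sup>2 * (norm (fps_nth Q (n - i)) * s ^ (n - i)) \<le> M"
        using mult_left_mono[OF M2[of "n - i"], of "s\<^sup>2"] M by auto
    qed (auto intro!: mult_nonneg_nonneg simp: u_nonneg)
    also have "\<dots> = M * S n"
      by (simp add: S_def sum_distrib_left algebra_simps)
    finally show ?thesis
      by (simp add: u_def mult.assoc)
  qed
  \<comment> \<open>The growth factor tends to 1, so the ratio test applies to \<open>S n * c ^ n\<close> for every \<open>c < 1\<close>.\<close>
  have S_Suc: "S (Suc n) \<le> (1 + (M + 1) / real (n + 1)) * S n" for n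
  proof -
    have "real (n + 1) * u (n + 1) \<le> (\<Sum>i\<in>{n}. real (Suc i) * u (Suc i) + u i)"
      using u_nonneg by simp
    also have "\<dots> \<le> S n"
      unfolding S_def
      by (intro sum_mono2) (auto intro!: add_nonneg_nonneg mult_nonneg_nonneg simp: u_nonneg)
    finally have "u (n + 1) \<le> S n / real (n + 1)"
      by (simp add: field_simps)
    moreover have "real (n + 2) * u (n + 2) \<le> M * S n / real (n + 1)"
      using recurrence[of n] by (simp add: field_simps)
    \<comment> \<open>Both parts of the increment are at most a constant times
      \<open>S n / (n + 1)\<close>: the first by the recurrence, the second because
      \<open>(n + 1) * u (n + 1)\<close> already occurs in \<open>S n\<close>.\<close>
    moreover have "S (Suc n) = S n + (real (n + 2) * u (n + 2) + u (n + 1))"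
      by (simp add: S_def)
    ultimately have "S (Suc n) \<le> S n + (M * S n / real (n + 1) + S n / real (n + 1))"
      by linarith
    then show ?thesis
      by (simp add: add_divide_distrib algebra_simps)
  qed
  \<comment> \<open>From \<open>N\<close> on, the ratio \<open>c * (1 + (M + 1) / (n + 1))\<close>
    stays below the midpoint \<open>(1 + c) / 2\<close> of \<open>c\<close> and 1.\<close>
  obtain N where N: "c * (M + 1) / ((1 - c) / 2) \<le> real N"
    using real_arch_simple by blast
  have "summable (\<lambda>n. S n * c ^ n)"
  proof (rule summable_ratio_test)
    show "(1 + c) / 2 < 1"
      using c by simp
    fix n assume "N \<le> n"
    then have "c * (M + 1) / ((1 - c) / 2) \<le> real (n + 1)"
      using N by linarith
    then have "c * ((M + 1) / real (n + 1)) \<le> (1 - c) / 2"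
      using c by (simp add: field_simps)
    then have *: "c * (1 + (M + 1) / real (n + 1)) \<le> (1 + c) / 2"
      by (simp add: algebra_simps)
    have "S (Suc n) * c ^ Suc n \<le> (1 + (M + 1) / real (n + 1)) * S n * c ^ Suc n"
      using c by (intro mult_right_mono S_Suc) auto
    also have "\<dots> = c * (1 + (M + 1) / real (n + 1)) * (S n * c ^ n)"
      by simp
    also have "\<dots> \<le> (1 + c) / 2 * (S n * c ^ n)"
      using c S_nonneg by (intro mult_right_mono[OF *]) auto
    finally show "norm (S (Suc n) * c ^ Suc n) \<le> (1 + c) / 2 * norm (S n * c ^ n)"
      using c S_nonneg by (simp add: abs_mult)
  qed
  moreover have "norm (fps_nth A n * of_real t ^ n) \<le> S n * c ^ n" for n
  proof -
    have "u n \<le> (\<Sum>i\<in>{n}. real (Suc i) * u (Suc i) + u i)"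
      using u_nonneg by simp
    also have "\<dots> \<le> S n"
      unfolding S_def
      by (intro sum_mono2) (auto intro!: add_nonneg_nonneg mult_nonneg_nonneg simp: u_nonneg)
    finally have "u n * c ^ n \<le> S n * c ^ n"
      using c by (intro mult_right_mono) auto
    moreover have "norm (fps_nth A n * of_real t ^ n) = u n * c ^ n"
      using c ts by (simp add: u_def norm_mult norm_power power_mult_distrib)
    ultimately show ?thesis by simp
  qed
  ultimately show "summable (\<lambda>n. fps_nth A n * of_real t ^ n)"
    by (rule summable_comparison_test'[where N = 0])
qed

text \<open>Near 0 the equation is an identity of formal power series, which gives the radius. The
  conclusion concerns the sum of the series instead of \<open>G\<close>, because \<open>V\<close>
  may be disconnected and the two are only known to agree near 0.\<close>

lemma linear_ode2_taylor:
  fixes G p q :: "complex \<Rightarrow> complex"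
  assumes hol: "p holomorphic_on ball 0 R" "q holomorphic_on ball 0 R" "G holomorphic_on V"
    and V: "open V" "0 \<in> V" and "R > 0"
    and ode: "\<And>w. w \<in> V \<Longrightarrow> deriv (deriv G) w + p w * deriv G w + q w * G w = 0"
  shows "ereal R \<le> fps_conv_radius (fps_expansion G 0)"
    and "w \<in> ball 0 R \<Longrightarrow> deriv (deriv (eval_fps (fps_expansion G 0))) w
           + p w * deriv (eval_fps (fps_expansion G 0)) w + q w * eval_fps (fps_expansion G 0) w = 0"
proof -
  define g where "g = eval_fps (fps_expansion G 0)"
  have G: "G has_fps_expansion fps_expansion G 0"
    using V hol by blast
  have pq: "p has_fps_expansion fps_expansion p 0" "q has_fps_expansion fps_expansion q 0"
    using hol \<open>R > 0\<close> by (auto intro!: has_fps_expansion_fps_expansion[of "ball 0 R"])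
  have "(\<lambda>w. deriv (deriv G) w + p w * deriv G w + q w * G w) has_fps_expansion
      fps_deriv (fps_deriv (fps_expansion G 0)) + fps_expansion p 0 * fps_deriv (fps_expansion G 0)
        + fps_expansion q 0 * fps_expansion G 0"
    by (intro fps_expansion_intros G pq)
  moreover have "\<forall>\<^sub>F w in nhds 0. w \<in> V"
    using V by (intro eventually_nhds_in_open)
  then have "\<forall>\<^sub>F w in nhds 0. deriv (deriv G) w + p w * deriv G w + q w * G w = 0"
    by eventually_elim (rule ode)
  ultimately have "(\<lambda>_. 0) has_fps_expansion
      fps_deriv (fps_deriv (fps_expansion G 0)) + fps_expansion p 0 * fps_deriv (fps_expansion G 0)
        + fps_expansion q 0 * fps_expansion G 0"
    by (subst (asm) has_fps_expansion_cong[OF _ refl])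
  then have "fps_deriv (fps_deriv (fps_expansion G 0))
      + fps_expansion p 0 * fps_deriv (fps_expansion G 0) + fps_expansion q 0 * fps_expansion G 0 = 0"
    by (rule fps_expansion_unique_complex[OF _ has_fps_expansion_0])
  note fps_linear_ode2_conv_radius[OF this]
  moreover have "ereal R \<le> min (fps_conv_radius (fps_expansion p 0)) (fps_conv_radius (fps_expansion q 0))"
    using hol by (auto intro!: conv_radius_fps_expansion)
  ultimately show radius: "ereal R \<le> fps_conv_radius (fps_expansion G 0)"
    by (rule order_trans[rotated])
  have hol_g: "g holomorphic_on ball 0 R"
    unfolding g_def using radius
    by (intro holomorphic_on_eval_fps ball_eball_mono)
  obtain r where r: "r > 0" "ball 0 r \<subseteq> V \<inter> ball 0 R"
    using V \<open>R > 0\<close> open_contains_ball[of "V \<inter> ball 0 R"] by (metis IntI centre_in_ball open_Int open_ball)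
  have eq: "g w = G w" if "w \<in> ball 0 r" for w
    unfolding g_def using r that holomorphic_on_subset[OF hol(3)]
    by (subst eval_fps_expansion'[of G 0 "ereal r"]) auto
  have near: "\<forall>\<^sub>F v in nhds w. v \<in> ball 0 r" if "w \<in> ball 0 r" for w :: complex
    using that by (intro eventually_nhds_in_open) auto
  have deriv_eq: "deriv g w = deriv G w" if "w \<in> ball 0 r" for w
    by (rule deriv_cong_ev[OF eventually_mono[OF near[OF that] eq] refl])
  have deriv2_eq: "deriv (deriv g) w = deriv (deriv G) w" if "w \<in> ball 0 r" for w
    by (rule deriv_cong_ev[OF eventually_mono[OF near[OF that] deriv_eq] refl])
  show "deriv (deriv g) w + p w * deriv g w + q w * g w = 0" if w: "w \<in> ball 0 R"
  \<comment> \<open>The left-hand side of the equation for \<open>g\<close> is holomorphic on the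
    connected disc \<open>ball 0 R\<close> and vanishes on the small disc where
    \<open>g = G\<close>.\<close>
  proof (rule analytic_continuation_open[where s = "ball 0 r" and s' = "ball 0 R"
          and f = "\<lambda>w. deriv (deriv g) w + p w * deriv g w + q w * g w" and g = "\<lambda>_. 0"])
    show "(\<lambda>w. deriv (deriv g) w + p w * deriv g w + q w * g w) holomorphic_on ball 0 R"
      by (intro holomorphic_intros hol hol_g) auto
    fix w :: complex assume "w \<in> ball 0 r"
    then show "deriv (deriv g) w + p w * deriv g w + q w * g w = 0"
      using ode[of w] r eq deriv_eq deriv2_eq by auto
  qed (use r w in auto)
qed

text \<open>Both coefficients of the equation are holomorphic on any disc about 0 that contains no
  singular point, so the Taylor series converges at least up to the nearest one.\<close>

lemma heun_solution_on_taylor: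
  assumes sol: "heun_solution_on a b mu V G" and "0 \<in> V" and "R > 0"
    and a: "\<And>j. j \<in> {1..4} \<Longrightarrow> R \<le> norm (a j)"
  shows "ereal R \<le> fps_conv_radius (fps_expansion G 0)"
    and "heun_solution_on a b mu (ball 0 R) (eval_fps (fps_expansion G 0))"
proof -
  define p where "p w = 1/2 * (\<Sum>j=1..4. 1 / (w - a j))" for w
  define q where "q w = 1 / (\<Prod>j=1..4. w - a j) * (mu + (\<Sum>j=1..4. b j / (w - a j)))" for w
  have ball: "a j \<notin> ball 0 R" if "j \<in> {1..4}" for j
    using a[OF that] by simp
  have hol: "p holomorphic_on ball 0 R" "q holomorphic_on ball 0 R"
    using ball unfolding p_def q_def by (auto intro!: holomorphic_intros)
  have G: "open V" "G holomorphic_on V"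
    and ode: "\<And>w. w \<in> V \<Longrightarrow> deriv (deriv G) w + p w * deriv G w + q w * G w = 0"
    using sol by (auto simp: heun_solution_on_def p_def q_def)
  note taylor = linear_ode2_taylor[OF hol G(2,1) \<open>0 \<in> V\<close> \<open>R > 0\<close> ode]
  show radius: "ereal R \<le> fps_conv_radius (fps_expansion G 0)"
    by (rule taylor(1))
  then have "eval_fps (fps_expansion G 0) holomorphic_on ball 0 R"
    by (intro holomorphic_on_eval_fps ball_eball_mono)
  then show "heun_solution_on a b mu (ball 0 R) (eval_fps (fps_expansion G 0))"
    using taylor(2) ball unfolding heun_solution_on_def p_def q_def by simp
qed

section \<open>The substitution of the reciprocal variable\<close>

lemma open_reciprocal_image:
  fixes U :: "complex set"
  assumes "open U"
  shows "open {w. w \<noteq> 0 \<and> 1 / w \<in> U}"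
proof -
  have "open (- {0} \<inter> (\<lambda>w. 1 / w) -` U)"
    using assms by (intro continuous_open_preimage continuous_intros) auto
  also have "- {0} \<inter> (\<lambda>w. 1 / w) -` U = {w. w \<noteq> 0 \<and> 1 / w \<in> U}"
    by auto
  finally show ?thesis .
qed

lemma deriv_compose_reciprocal:
  fixes F :: "complex \<Rightarrow> complex"
  assumes "open U" "F holomorphic_on U" "w \<noteq> 0" "1 / w \<in> U"
  shows "deriv (\<lambda>w. F (1 / w)) w = - deriv F (1 / w) / w\<^sup>2"
    and "deriv (deriv (\<lambda>w. F (1 / w))) w = deriv (deriv F) (1 / w) / w ^ 4 + 2 * deriv F (1 / w) / w ^ 3"
proof -
  have recip: "((\<lambda>w. 1 / w) has_field_derivative - 1 / w\<^sup>2) (at w)" if "w \<noteq> 0" for w :: complex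
    using that by (auto intro!: derivative_eq_intros simp: power2_eq_square)
  have chain: "((\<lambda>w. H (1 / w)) has_field_derivative - deriv H (1 / w) / w\<^sup>2) (at w)"
    if "H holomorphic_on U" "w \<noteq> 0" "1 / w \<in> U" for H and w :: complex
    using DERIV_chain2[OF holomorphic_derivI[OF that(1) \<open>open U\<close> that(3)] recip[OF that(2)]] by simp
  have d1: "deriv (\<lambda>w. F (1 / w)) w = - deriv F (1 / w) / w\<^sup>2" if "w \<noteq> 0" "1 / w \<in> U" for w
    using chain[OF assms(2) that] by (rule DERIV_imp_deriv)
  show "deriv (\<lambda>w. F (1 / w)) w = - deriv F (1 / w) / w\<^sup>2"
    using assms(3,4) by (rule d1)
  \<comment> \<open>Differentiating a second time requires the formula for the first derivative on a
    whole neighbourhood of \<open>w\<close>.\<close>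
  have "\<forall>\<^sub>F v in nhds w. v \<in> {v. v \<noteq> 0 \<and> 1 / v \<in> U}"
    using assms by (intro eventually_nhds_in_open open_reciprocal_image) auto
  then have "\<forall>\<^sub>F v in nhds w. deriv (\<lambda>w. F (1 / w)) v = - deriv F (1 / v) / v\<^sup>2"
    by eventually_elim (auto simp: d1)
  then have "deriv (deriv (\<lambda>w. F (1 / w))) w = deriv (\<lambda>v. - deriv F (1 / v) / v\<^sup>2) w"
    by (rule deriv_cong_ev) simp
  also have "\<dots> = deriv (deriv F) (1 / w) / w ^ 4 + 2 * deriv F (1 / w) / w ^ 3"
  proof (rule DERIV_imp_deriv)
    have "deriv F holomorphic_on U"
      using assms by (intro holomorphic_deriv)
    note d = chain[OF this assms(3,4)]
    show "((\<lambda>v. - deriv F (1 / v) / v\<^sup>2) has_field_derivative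
        deriv (deriv F) (1 / w) / w ^ 4 + 2 * deriv F (1 / w) / w ^ 3) (at w)"
      using assms(3)
      by (auto intro!: derivative_eq_intros d simp: field_simps eval_nat_numeral)
  qed
  finally show "deriv (deriv (\<lambda>w. F (1 / w))) w =
      deriv (deriv F) (1 / w) / w ^ 4 + 2 * deriv F (1 / w) / w ^ 3" .
qed

text \<open>The transformed left-hand side at \<open>w\<close> is \<open>w ^ (-4)\<close> times the
  original one at \<open>1 / w\<close>, so they vanish together; as 0 is not in \<open>U\<close>,
  taking reciprocals is a bijection between the two domains. The points \<open>z j\<close> enter
  only through their product and the shift of \<open>mu\<close>.\<close>

lemma heun_solution_on_reciprocal:
  fixes z q :: "nat \<Rightarrow> complex"
  assumes z: "(\<Prod>j=1..4. z j) = 1"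
    and U: "open U" "0 \<notin> U" "\<And>j. j \<in> {1..4} \<Longrightarrow> z j \<notin> U" and F: "F holomorphic_on U"
    and mu': "mu' = mu - (\<Sum>j=1..4. q j / z j)"
  shows "heun_solution_on z q mu U F \<longleftrightarrow>
    heun_solution_on (\<lambda>j. 1 / z j) (\<lambda>j. - q j / (z j)\<^sup>2) mu' {w. w \<noteq> 0 \<and> 1 / w \<in> U} (\<lambda>w. F (1 / w))"
proof -
  define W where "W = {w. w \<noteq> 0 \<and> 1 / w \<in> U}"
  define E where "E x = deriv (deriv F) x + 1/2 * (\<Sum>j=1..4. 1 / (x - z j)) * deriv F x
    + 1 / (\<Prod>j=1..4. x - z j) * (mu + (\<Sum>j=1..4. q j / (x - z j))) * F x" for x
  define E' where "E' w = deriv (deriv (\<lambda>w. F (1 / w))) w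
    + 1/2 * (\<Sum>j=1..4. 1 / (w - 1 / z j)) * deriv (\<lambda>w. F (1 / w)) w
    + 1 / (\<Prod>j=1..4. w - 1 / z j)
        * (mu' + (\<Sum>j=1..4. - q j / (z j)\<^sup>2 / (w - 1 / z j))) * F (1 / w)" for w
  have z0: "z j \<noteq> 0" if "j \<in> {1..4}" for j
    using z that by (metis finite_atLeastAtMost prod_zero_iff zero_neq_one)
  have W: "open W"
    unfolding W_def using U(1) by (rule open_reciprocal_image)
  have avoid: "1 / z j \<notin> W" if "j \<in> {1..4}" for j
    using U(3)[OF that] z0[OF that] by (simp add: W_def)
  have hol: "(\<lambda>w. F (1 / w)) holomorphic_on W"
    by (rule holomorphic_on_compose_gen[OF _ F, unfolded o_def])
       (auto intro!: holomorphic_intros simp: W_def)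
  have E': "E' w = E (1 / w) / w ^ 4" if "w \<in> W" for w
  proof -
    have w: "w \<noteq> 0" "1 / w \<in> U"
      using that by (auto simp: W_def)
    have ne: "w - 1 / z j \<noteq> 0" "1 / w - z j \<noteq> 0" if "j \<in> {1..4}" for j
      using avoid[OF that] \<open>w \<in> W\<close> U(3)[OF that] w(2) by auto
    \<comment> \<open>In the product over four points the signs cancel and the \<open>z j\<close>
      multiply to 1, which leaves the factor \<open>w ^ (-4)\<close>.\<close>
    have factor: "1 / w - z j = z j * (w - 1 / z j) * (- 1 / w)" if "j \<in> {1..4}" for j
      using z0[OF that] w by (simp add: field_simps)
    have "(\<Prod>j=1..4. 1 / w - z j) = (\<Prod>j=1..4. z j * (w - 1 / z j) * (- 1 / w))"
      using factor by (intro prod.cong) auto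
    also have "\<dots> = (\<Prod>j=1..4. z j) * (\<Prod>j=1..4. w - 1 / z j) / w ^ 4"
      by (simp only: prod.distrib prod_constant) (simp add: power_divide)
    finally have P: "(\<Prod>j=1..4. 1 / w - z j) = (\<Prod>j=1..4. w - 1 / z j) / w ^ 4"
      using z by simp
    \<comment> \<open>The four terms \<open>w\<close> add up to \<open>4 * w\<close>; halved and
      divided by \<open>w ^ 4\<close>, this matches the term
      \<open>2 * deriv F (1 / w) / w ^ 3\<close> from the second derivative.\<close>
    have "1 / (1 / w - z j) = w - w\<^sup>2 / (w - 1 / z j)" if "j \<in> {1..4}" for j
      using z0[OF that] w ne[OF that] unfolding factor[OF that]
      by (simp add: divide_simps power2_eq_square) (simp add: algebra_simps)
    then have "(\<Sum>j=1..4. 1 / (1 / w - z j)) = (\<Sum>j\<in>{1..4::nat}. w - w\<^sup>2 * (1 / (w - 1 / z j)))"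
      by (intro sum.cong) auto
    also have "\<dots> = 4 * w - w\<^sup>2 * (\<Sum>j=1..4. 1 / (w - 1 / z j))"
      by (simp add: sum_subtractf sum_distrib_left)
    finally have S: "(\<Sum>j=1..4. 1 / (1 / w - z j)) = 4 * w - w\<^sup>2 * (\<Sum>j=1..4. 1 / (w - 1 / z j))" .
    \<comment> \<open>The constants \<open>- q j / z j\<close> of these partial fractions are what
      \<open>mu'\<close> absorbs.\<close>
    have "q j / (1 / w - z j) = - q j / (z j)\<^sup>2 / (w - 1 / z j) - q j / z j" if "j \<in> {1..4}" for j
      using z0[OF that] w ne[OF that] unfolding factor[OF that]
      by (simp add: divide_simps power2_eq_square) (simp add: algebra_simps)
    then have "(\<Sum>j=1..4. q j / (1 / w - z j)) =
        (\<Sum>j=1..4. - q j / (z j)\<^sup>2 / (w - 1 / z j) - q j / z j)"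
      by (intro sum.cong) auto
    then have V: "mu + (\<Sum>j=1..4. q j / (1 / w - z j)) =
        mu' + (\<Sum>j=1..4. - q j / (z j)\<^sup>2 / (w - 1 / z j))"
      by (simp only: mu' sum_subtractf) simp
    note d = deriv_compose_reciprocal[OF U(1) F w]
    show ?thesis
      unfolding E_def E'_def d S V P using w
      by (simp add: field_simps eval_nat_numeral)
  qed
  have "(\<forall>x\<in>U. E x = 0) \<longleftrightarrow> (\<forall>w\<in>W. E' w = 0)"
  proof
    assume "\<forall>x\<in>U. E x = 0"
    then show "\<forall>w\<in>W. E' w = 0"
      using E' by (simp add: W_def)
  next
    assume *: "\<forall>w\<in>W. E' w = 0"
    show "\<forall>x\<in>U. E x = 0"
    proof
      fix x assume "x \<in> U"
      then have "x \<noteq> 0" "1 / x \<in> W"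
        using U(2) by (auto simp: W_def)
      then show "E x = 0"
        using * E'[of "1 / x"] by simp
    qed
  qed
  then show ?thesis
    unfolding heun_solution_on_def W_def[symmetric]
    using U F W avoid hol by (simp add: E_def E'_def)
qed

section \<open>The circular case and its Laurent series\<close>

theorem proposition4:
  fixes \<phi> :: real and chi z q :: "nat \<Rightarrow> complex" and lam lam' \<rho>\<^sub>2 :: complex
  assumes phi: "sin (2 * \<phi>) \<noteq> 0"
    and z1: "z 1 = exp (\<i> * of_real \<phi>)"
    and z2: "z 2 = - exp (- \<i> * of_real \<phi>)"
    and z3: "z 3 = - exp (\<i> * of_real \<phi>)"
    and z4: "z 4 = exp (- \<i> * of_real \<phi>)"
    and q: "\<And>j. j \<in> {1..4} \<Longrightarrow>
              q j = 1/16 * (sin (2 * chi j))\<^sup>2 * (\<Prod>k\<in>{1..4} - {j}. z j - z k)"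
    and rho2: "\<rho>\<^sub>2 = (sin (2 * chi 1))\<^sup>2 + (sin (2 * chi 3))\<^sup>2
                  - (sin (2 * chi 2))\<^sup>2 - (sin (2 * chi 4))\<^sup>2"
    and lam': "lam' = lam - \<i> / 4 * of_real (sin (2 * \<phi>)) * \<rho>\<^sub>2"
  shows "(\<forall>U F. open U \<longrightarrow> U \<subseteq> - ({0} \<union> z ` {1..4}) \<longrightarrow> F holomorphic_on U \<longrightarrow>
            (heun_solution_on z q lam U F \<longleftrightarrow>
             heun_solution_on (\<lambda>j. 1 / z j) (\<lambda>j. - q j / (z j)\<^sup>2) lam'
               {w. w \<noteq> 0 \<and> 1 / w \<in> U} (\<lambda>w. F (1 / w))))
       \<and> (\<forall>V G f. 0 \<in> V \<longrightarrow>
            heun_solution_on (\<lambda>j. 1 / z j) (\<lambda>j. - q j / (z j)\<^sup>2) lam' V G \<longrightarrow>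
            (\<forall>n. f n = (deriv ^^ n) G 0 / fact n) \<longrightarrow>
            (\<forall>x. norm x > 1 \<longrightarrow> summable (\<lambda>n. norm (f n * x powi (- int n)))) \<and>
            heun_solution_on z q lam {x. norm x > 1} (\<lambda>x. \<Sum>n. f n * x powi (- int n)))"
proof -
  \<comment> \<open>Otherwise the simplifier turns \<open>z 1\<close> into \<open>z (Suc 0)\<close>,
    and the equations for \<open>z 1\<close> no longer match.\<close>
  note One_nat_def [simp del]
  have idx: "{1..4} = {1, 2, 3, 4::nat}"
    by auto
  define e e' where "e = exp (\<i> * of_real \<phi>)" and "e' = exp (- \<i> * of_real \<phi>)"
  have z: "z 1 = e" "z 2 = - e'" "z 3 = - e" "z 4 = e'"
    using z1 z2 z3 z4 by (simp_all add: e_def e'_def)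
  have e: "e * e' = 1" "e \<noteq> 0" "e' \<noteq> 0" "norm e = 1" "norm e' = 1"
    by (simp_all add: e_def e'_def flip: exp_add)
  have prod: "(\<Prod>j=1..4. z j) = 1"
    using e(1) by (simp add: idx z algebra_simps)
  have norm_z: "norm (z j) = 1" if "j \<in> {1..4}" for j
    using that e unfolding idx by (auto simp: z)
  have "of_real (sin (2 * \<phi>)) = (e\<^sup>2 - e'\<^sup>2) / (2 * \<i>)"
    by (simp add: e_def e'_def sin_exp_eq algebra_simps flip: exp_double sin_of_real)
  then have sin_eq: "e\<^sup>2 - e'\<^sup>2 = 2 * \<i> * of_real (sin (2 * \<phi>))"
    by (simp add: field_simps)
  have minus: "{1..4} - {1} = {2, 3, 4::nat}" "{1..4} - {2} = {1, 3, 4::nat}"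
    "{1..4} - {3} = {1, 2, 4::nat}" "{1..4} - {4} = {1, 2, 3::nat}"
    by auto
  \<comment> \<open>These are the values \<open>P'(z_j)\<close> for
    \<open>P(x) = (x^2 - e^2) (x^2 - e'^2)\<close>. The opposite signs at the two pairs of roots
    produce the signs in \<open>\<rho>\<^sub>2\<close>.\<close>
  have differences:
    "(\<Prod>k\<in>{1..4} - {1}. z 1 - z k) = 2 * (e\<^sup>2 - e'\<^sup>2) * z 1"
    "(\<Prod>k\<in>{1..4} - {2}. z 2 - z k) = - 2 * (e\<^sup>2 - e'\<^sup>2) * z 2"
    "(\<Prod>k\<in>{1..4} - {3}. z 3 - z k) = 2 * (e\<^sup>2 - e'\<^sup>2) * z 3"
    "(\<Prod>k\<in>{1..4} - {4}. z 4 - z k) = - 2 * (e\<^sup>2 - e'\<^sup>2) * z 4"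
    unfolding minus by (simp_all add: z) (simp_all add: algebra_simps power2_eq_square)
  have quot: "q j / z j = c / 16 * (sin (2 * chi j))\<^sup>2"
    if "j \<in> {1..4}" "(\<Prod>k\<in>{1..4} - {j}. z j - z k) = c * z j" for j c
    using norm_z[OF that(1)] by (subst q[OF that(1)], subst that(2)) auto
  have quots:
    "q 1 / z 1 = 2 * (e\<^sup>2 - e'\<^sup>2) / 16 * (sin (2 * chi 1))\<^sup>2"
    "q 2 / z 2 = - 2 * (e\<^sup>2 - e'\<^sup>2) / 16 * (sin (2 * chi 2))\<^sup>2"
    "q 3 / z 3 = 2 * (e\<^sup>2 - e'\<^sup>2) / 16 * (sin (2 * chi 3))\<^sup>2"
    "q 4 / z 4 = - 2 * (e\<^sup>2 - e'\<^sup>2) / 16 * (sin (2 * chi 4))\<^sup>2"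
    by (rule quot[OF _ differences(1)] quot[OF _ differences(2)]
        quot[OF _ differences(3)] quot[OF _ differences(4)]; simp)+
  have "(\<Sum>j=1..4. q j / z j) = q 1 / z 1 + q 2 / z 2 + q 3 / z 3 + q 4 / z 4"
    by (simp add: idx)
  also have "\<dots> = (e\<^sup>2 - e'\<^sup>2) / 8 * \<rho>\<^sub>2"
    unfolding quots rho2 by (simp add: field_simps)
  finally have "(\<Sum>j=1..4. q j / z j) = (e\<^sup>2 - e'\<^sup>2) / 8 * \<rho>\<^sub>2" .
  \<comment> \<open>Since \<open>e^2 - e'^2 = 2 i sin (2 \<phi>)\<close>, the factor 1/8 becomes the
    prescribed \<open>i/4 * sin (2 \<phi>)\<close>.\<close>
  then have lam'_eq: "lam' = lam - (\<Sum>j=1..4. q j / z j)"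
    by (simp add: lam' sin_eq)
  note reciprocal = heun_solution_on_reciprocal[OF prod _ _ _ _ lam'_eq]
  have a: "heun_solution_on z q lam U F \<longleftrightarrow>
             heun_solution_on (\<lambda>j. 1 / z j) (\<lambda>j. - q j / (z j)\<^sup>2) lam'
               {w. w \<noteq> 0 \<and> 1 / w \<in> U} (\<lambda>w. F (1 / w))"
    if "open U" "U \<subseteq> - ({0} \<union> z ` {1..4})" "F holomorphic_on U" for U F
    using that by (intro reciprocal) auto
  have b: "(\<forall>x. norm x > 1 \<longrightarrow> summable (\<lambda>n. norm (f n * x powi (- int n)))) \<and>
            heun_solution_on z q lam {x. norm x > 1} (\<lambda>x. \<Sum>n. f n * x powi (- int n))"
    if "0 \<in> V" and sol: "heun_solution_on (\<lambda>j. 1 / z j) (\<lambda>j. - q j / (z j)\<^sup>2) lam' V G"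
      and f: "\<forall>n. f n = (deriv ^^ n) G 0 / fact n" for V G f
  proof -
    define g where "g = eval_fps (fps_expansion G 0)"
    define U where "U = {x :: complex. norm x > 1}"
    \<comment> \<open>The transformed singular points also lie on the unit circle, so
      \<open>R = 1\<close> is admissible.\<close>
    have norm_a: "1 \<le> norm (1 / z j)" if "j \<in> {1..4}" for j
      using norm_z[OF that] by (simp add: norm_divide)
    note taylor = heun_solution_on_taylor[OF sol \<open>0 \<in> V\<close> zero_less_one norm_a, folded g_def]
    have f_nth: "f n = fps_nth (fps_expansion G 0) n" for n
      using f by (simp add: fps_expansion_def)
    have term_eq: "f n * x powi (- int n) = fps_nth (fps_expansion G 0) n * (1 / x) ^ n" for n x
      by (simp add: f_nth power_int_minus power_one_over inverse_eq_divide)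
    have reciprocal_less_1: "norm (1 / x) < 1" if "norm x > 1" for x :: complex
      using that by (simp add: norm_divide divide_less_eq_1)
    have "summable (\<lambda>n. norm (f n * x powi (- int n)))" if "norm x > 1" for x
    proof -
      have "ereal (norm (1 / x)) < fps_conv_radius (fps_expansion G 0)"
        using reciprocal_less_1[OF that] by (auto intro!: less_le_trans[OF _ taylor(1)])
      then show ?thesis
        unfolding term_eq by (intro norm_summable_fps) simp
    qed
    moreover have "heun_solution_on z q lam U (\<lambda>x. \<Sum>n. f n * x powi (- int n))"
    proof -
      have series: "(\<lambda>x. \<Sum>n. f n * x powi (- int n)) = (\<lambda>x. g (1 / x))"
        unfolding term_eq g_def eval_fps_def ..
      \<comment> \<open>The centre 0 corresponds to the point at infinity, so \<open>g\<close> is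
        restricted to the punctured disc before the substitution.\<close>
      have punctured: "{w. w \<noteq> 0 \<and> 1 / w \<in> U} = ball 0 1 - {0}"
        by (auto simp: U_def norm_divide field_simps)
      have U: "open U"
        unfolding U_def by (intro open_Collect_less continuous_intros)
      have hol_g: "g holomorphic_on ball 0 1"
        using taylor(2) by (simp add: heun_solution_on_def)
      have "(\<lambda>x. g (1 / x)) holomorphic_on U"
        by (rule holomorphic_on_compose_gen[OF _ hol_g, unfolded o_def])
           (use reciprocal_less_1 in \<open>auto intro!: holomorphic_intros simp: U_def\<close>)
      moreover have "heun_solution_on (\<lambda>j. 1 / z j) (\<lambda>j. - q j / (z j)\<^sup>2) lam' (ball 0 1 - {0}) g"
        using taylor(2) by (auto simp: heun_solution_on_def intro: holomorphic_on_subset)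
      moreover have "U \<subseteq> - ({0} \<union> z ` {1..4})"
        using norm_z by (force simp: U_def)
      \<comment> \<open>The equivalence is used from right to left for the function
        \<open>g (1 / x)\<close>, whose own substitution gives back \<open>g\<close>.\<close>
      ultimately show ?thesis
        unfolding series using U by (subst a) (simp_all add: punctured)
    qed
    ultimately show ?thesis
      by (simp add: U_def)
  qed
  show ?thesis
    using a b by blast
qed

end
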